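(* For any $n\ge1$ and any pattern pair $p\in\{(011,021),(010,021)\}$, we have $|\mathbf{I}_n(p)|=C_n$, where $C_n=\frac{1}{n+1}\binom{2n}{n}$ is the $n$-th Catalan number.
   Context: An inversion sequence of length $n$ is an integer sequence $e=(e_1,\dots,e_n)$ with $0\le e_i\le i-1$ for all $1\le i\le n$. A word $w_1\cdots w_n$ avoids a pattern $P=p_1\cdots p_k$ if there are no $i_1<\cdots<i_k$ such that $w_{i_1}\cdots w_{i_k}$ is order isomorphic to $P$ (equal letters of $P$ corresponding to equal entries). For a pair $p=(P_1,P_2)$ of patterns, $\mathbf{I}_n(p)$ denotes the set of inversion sequences of length $n$ avoiding both $P_1$ and $P_2$. *)

theory Defs
  imports Complex_Main "HOL-Library.Sublist"
begin

text \<open>Lists are indexed from 0, so the condition \<open>0 \<le> e\<^sub>i \<le> i - 1\<close> for \<open>1 \<le> i \<le> n\<close>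
  becomes \<open>e ! i \<le> i\<close> for \<open>i < n\<close>.\<close>

definition inversion_sequences :: "nat \<Rightarrow> nat list set" where
  "inversion_sequences n = {e. length e = n \<and> (\<forall>i<n. e ! i \<le> i)}"

definition order_isomorphic :: "nat list \<Rightarrow> nat list \<Rightarrow> bool" where
  "order_isomorphic u v \<longleftrightarrow> length u = length v \<and>
     (\<forall>i<length u. \<forall>j<length u.
        (u ! i < u ! j \<longleftrightarrow> v ! i < v ! j) \<and> (u ! i = u ! j \<longleftrightarrow> v ! i = v ! j))"

definition avoids :: "nat list \<Rightarrow> nat list \<Rightarrow> bool" where
  "avoids w P \<longleftrightarrow> \<not> (\<exists>u. subseq u w \<and> order_isomorphic u P)"

definition inversion_sequences_avoiding :: "nat \<Rightarrow> nat list \<times> nat list \<Rightarrow> nat list set" where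
  "inversion_sequences_avoiding n p =
     {e \<in> inversion_sequences n. avoids e (fst p) \<and> avoids e (snd p)}"

definition catalan :: "nat \<Rightarrow> real" where
  "catalan n = 1 / (real n + 1) * real ((2 * n) choose n)"

end

theory Submission imports Defs begin

text \<open>
  A nonempty inversion sequence starts with \<open>0\<close>, so it contains \<open>021\<close> as soon as two nonzero
  entries descend, and \<open>011\<close> as soon as a nonzero value is repeated; a \<open>0\<close> after a nonzero entry
  completes a \<open>010\<close>. Hence avoiding \<open>(011,021)\<close> means that the nonzero entries strictly increase, and
  avoiding \<open>(010,021)\<close> means that the whole sequence weakly increases
  (\<open>avoids_011_021_iff\<close>, \<open>avoids_010_021_iff\<close>).

  Both properties \<open>Q\<close> share one feature that determines the count: a \<open>Q\<close>-word over \<open>{0..m}\<close> has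
  exactly one extension by a letter to a \<open>Q\<close>-word over \<open>{0..m}\<close> in which \<open>m\<close> occurs. For weakly
  increasing words that letter is \<open>m\<close>; when the nonzero entries strictly increase, it is \<open>0\<close> if \<open>m\<close>
  has already occurred and \<open>m\<close> otherwise. Deleting the last entry is therefore a bijection from the
  sequences of length \<open>n + 1\<close> with maximum \<open>m\<close> to the sequences of length \<open>n\<close> with maximum at
  most \<open>m\<close>, provided \<open>m \<le> n\<close>. So the number \<open>f n k\<close> of sequences of length \<open>n\<close> with entries at
  most \<open>k\<close> satisfies
  \<open>f (n + 1) (k + 1) = f (n + 1) k + f n (k + 1)\<close> for \<open>k < n\<close>, and \<open>f (n + 1) (n + 1) = f (n + 1) n\<close>
  since no entry can reach \<open>n + 1\<close>. This is the recurrence of the ballot numbers, whose diagonal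
  consists of the Catalan numbers (\<open>ballot_recurrence\<close>, \<open>catalan_eq_diff\<close>).
\<close>

section \<open>Ballot numbers\<close>

text \<open>
  The value is the one the reflection principle gives for lattice paths that stay weakly below the
  diagonal. Writing the subtracted term as \<open>(n + k) choose (n + 1)\<close> rather than as
  \<open>(n + k) choose (k - 1)\<close> makes it vanish at \<open>k = 0\<close>, so that off the diagonal the induction step
  is Pascal's rule alone.
\<close>

lemma ballot_recurrence:
  fixes f :: "nat \<Rightarrow> nat \<Rightarrow> nat"
  assumes zero: "\<And>n. f n 0 = 1"
    and step: "\<And>n k. k < n \<Longrightarrow> f (Suc n) (Suc k) = f (Suc n) k + f n (Suc k)"
    and diagonal: "\<And>n. f (Suc n) (Suc n) = f (Suc n) n"
  shows "k \<le> n \<Longrightarrow> f n k + (n + k choose Suc n) = (n + k choose n)"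
proof (induction n arbitrary: k)
  case 0
  then show ?case by (simp add: zero)
next
  case (Suc m)
  note below = Suc.IH
  from Suc.prems show ?case
  proof (induction k)
    case 0
    then show ?case by (simp add: zero)
  next
    case (Suc j)
    have left: "f (Suc m) j + (Suc m + j choose Suc (Suc m)) = (Suc m + j choose Suc m)"
      using Suc by simp
    show ?case
    proof (cases "j < m")
      case True
      then have "f m (Suc j) + (m + Suc j choose Suc m) = (m + Suc j choose m)"
        using below[of "Suc j"] by simp
      with left step[OF True] show ?thesis by simp
    next
      case False
      with Suc.prems have "j = m" by simp
      moreover have "(Suc m + m choose Suc m) = (Suc m + m choose m)"
        using binomial_symmetric[of m "Suc m + m"] by simp
      ultimately show ?thesis using left diagonal[of m] by simp
    qed
  qed
qed

lemma catalan_eq_diff: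
  assumes "c + (n + n choose Suc n) = (n + n choose n)"
  shows "real c = catalan n"
proof -
  have "Suc n * (n + n choose Suc n) = n * (n + n choose n)"
    using binomial_absorption[of n "n + n"] binomial_absorb_comp[of "n + n" n] by simp
  then have "Suc n * c = (n + n choose n)"
    using arg_cong[OF assms, of "\<lambda>x. Suc n * x"] by (simp add: algebra_simps)
  then have "(real n + 1) * real c = real (2 * n choose n)"
    by (metis mult_2 of_nat_Suc of_nat_mult add.commute)
  then show ?thesis by (simp add: catalan_def field_simps)
qed

section \<open>Inversion sequences with bounded entries\<close>

lemma snoc_in_inversion_sequences_iff:
  "e @ [x] \<in> inversion_sequences (Suc n) \<longleftrightarrow> e \<in> inversion_sequences n \<and> x \<le> n"
  by (auto simp: inversion_sequences_def nth_append less_Suc_eq)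

lemma finite_inversion_sequences: "finite (inversion_sequences n)"
proof (rule finite_subset)
  show "inversion_sequences n \<subseteq> {e. set e \<subseteq> {..n} \<and> length e = n}"
    unfolding inversion_sequences_def by (fastforce simp: in_set_conv_nth)
  show "finite {e. set e \<subseteq> {..n} \<and> length e = n}"
    by (rule finite_lists_length_eq) simp
qed

definition bounded_inversion_sequences :: "(nat list \<Rightarrow> bool) \<Rightarrow> nat \<Rightarrow> nat \<Rightarrow> nat list set" where
  "bounded_inversion_sequences Q n k = {e \<in> inversion_sequences n. Q e \<and> set e \<subseteq> {..k}}"

lemma finite_bounded_inversion_sequences: "finite (bounded_inversion_sequences Q n k)"
  by (simp add: bounded_inversion_sequences_def finite_inversion_sequences)

lemma bounded_inversion_sequences_full:
  assumes "n \<le> Suc k"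
  shows "bounded_inversion_sequences Q n k = {e \<in> inversion_sequences n. Q e}"
  using assms unfolding bounded_inversion_sequences_def inversion_sequences_def
  by (fastforce simp: in_set_conv_nth)

text \<open>
  The letter that \<open>extend\<close> appends is at most \<open>m\<close>, hence an admissible entry at position \<open>n\<close>
  because \<open>m \<le> n\<close>; so deleting the last entry has an inverse.
\<close>

lemma card_inversion_sequences_with_max:
  assumes prefix: "\<And>e x. Q (e @ [x]) \<Longrightarrow> Q e"
    and extend: "\<And>e m. Q e \<Longrightarrow> set e \<subseteq> {..m} \<Longrightarrow> \<exists>!x. x \<le> m \<and> m \<in> set (e @ [x]) \<and> Q (e @ [x])"
    and "m \<le> n"
  shows "card {e \<in> bounded_inversion_sequences Q (Suc n) m. m \<in> set e}
    = card (bounded_inversion_sequences Q n m)" (is "card ?A = card ?B")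
proof (rule bij_betw_same_card[of butlast], rule bij_betw_imageI)
  have snoc: "\<exists>e x. w = e @ [x] \<and> e \<in> ?B \<and> x \<le> m \<and> m \<in> set (e @ [x]) \<and> Q (e @ [x])"
    if w: "w \<in> ?A" for w
  proof -
    from w have "length w = Suc n"
      by (simp add: bounded_inversion_sequences_def inversion_sequences_def)
    then obtain e x where "w = e @ [x]" by (cases w rule: rev_cases) auto
    with w prefix[of e x] show ?thesis
      by (auto simp: bounded_inversion_sequences_def snoc_in_inversion_sequences_iff)
  qed
  show "inj_on butlast ?A"
  proof (rule inj_onI)
    fix v w assume "v \<in> ?A" "w \<in> ?A" and eq: "butlast v = butlast w"
    from snoc[OF \<open>v \<in> ?A\<close>] obtain e x where
      v: "v = e @ [x]" "e \<in> ?B" "x \<le> m \<and> m \<in> set (e @ [x]) \<and> Q (e @ [x])" by blast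
    from snoc[OF \<open>w \<in> ?A\<close>] obtain e' y where
      w: "w = e' @ [y]" "y \<le> m \<and> m \<in> set (e' @ [y]) \<and> Q (e' @ [y])" by blast
    from v(1) w(1) eq have "e' = e" by simp
    moreover have "x = y"
      using extend[of e m] v(2,3) w(2) \<open>e' = e\<close> by (auto simp: bounded_inversion_sequences_def)
    ultimately show "v = w" using v w by simp
  qed
  show "butlast ` ?A = ?B"
  proof (intro equalityI subsetI)
    fix u assume "u \<in> butlast ` ?A"
    then obtain w where "w \<in> ?A" "u = butlast w" by blast
    with snoc[OF \<open>w \<in> ?A\<close>] show "u \<in> ?B" by auto
  next
    fix e assume e: "e \<in> ?B"
    then obtain x where "x \<le> m" "m \<in> set (e @ [x])" "Q (e @ [x])"
      using extend[of e m] by (auto simp: bounded_inversion_sequences_def)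
    with e \<open>m \<le> n\<close> have "e @ [x] \<in> ?A"
      by (auto simp: bounded_inversion_sequences_def snoc_in_inversion_sequences_iff)
    then show "e \<in> butlast ` ?A" by (metis butlast_snoc image_eqI)
  qed
qed

text \<open>
  Among the sequences with entries at most \<open>k + 1\<close>, those that do not contain \<open>k + 1\<close> are bounded by
  \<open>k\<close> and the others have maximum \<open>k + 1\<close>; counting the latter by the preceding bijection gives
  the ballot recurrence.
\<close>

lemma card_inversion_sequences_eq_catalan:
  assumes nil: "Q []"
    and prefix: "\<And>e x. Q (e @ [x]) \<Longrightarrow> Q e"
    and extend: "\<And>e m. Q e \<Longrightarrow> set e \<subseteq> {..m} \<Longrightarrow> \<exists>!x. x \<le> m \<and> m \<in> set (e @ [x]) \<and> Q (e @ [x])"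
  shows "real (card {e \<in> inversion_sequences n. Q e}) = catalan n"
proof -
  let ?f = "\<lambda>n k. card (bounded_inversion_sequences Q n k)"
  have with_max: "card {e \<in> bounded_inversion_sequences Q (Suc n) m. m \<in> set e} = ?f n m"
    if "m \<le> n" for m n
    using prefix extend that by (rule card_inversion_sequences_with_max)
  have zero: "?f n 0 = 1" for n
  proof (induction n)
    case 0
    have "bounded_inversion_sequences Q 0 0 = {[]}"
      using nil by (auto simp: bounded_inversion_sequences_def inversion_sequences_def)
    then show ?case by simp
  next
    case (Suc n)
    \<comment> \<open>A nonempty word over \<open>{0}\<close> has maximum \<open>0\<close>.\<close>
    have "0 \<in> set e" if "e \<in> bounded_inversion_sequences Q (Suc n) 0" for e
      using that by (cases e) (auto simp: bounded_inversion_sequences_def inversion_sequences_def)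
    then have "{e \<in> bounded_inversion_sequences Q (Suc n) 0. 0 \<in> set e}
        = bounded_inversion_sequences Q (Suc n) 0"
      by blast
    with with_max[of 0 n] Suc.IH show ?case by simp
  qed
  have step: "?f (Suc n) (Suc k) = ?f (Suc n) k + ?f n (Suc k)" if "k < n" for n k
  proof -
    let ?max = "{e \<in> bounded_inversion_sequences Q (Suc n) (Suc k). Suc k \<in> set e}"
    have "bounded_inversion_sequences Q (Suc n) (Suc k)
        = bounded_inversion_sequences Q (Suc n) k \<union> ?max"
      by (auto simp: bounded_inversion_sequences_def le_Suc_eq)
    then have "?f (Suc n) (Suc k) = card (bounded_inversion_sequences Q (Suc n) k \<union> ?max)"
      by (rule arg_cong)
    also have "\<dots> = ?f (Suc n) k + card ?max"
      by (rule card_Un_disjoint)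
        (auto simp: bounded_inversion_sequences_def finite_inversion_sequences)
    also have "card ?max = ?f n (Suc k)"
      using that by (intro with_max) simp
    finally show ?thesis .
  qed
  have diagonal: "?f (Suc n) (Suc n) = ?f (Suc n) n" for n
    by (simp add: bounded_inversion_sequences_full)
  have "?f n n + (n + n choose Suc n) = (n + n choose n)"
    by (rule ballot_recurrence[of ?f, OF zero step diagonal]) auto
  then have "real (?f n n) = catalan n" by (rule catalan_eq_diff)
  then show ?thesis by (simp add: bounded_inversion_sequences_full)
qed

section \<open>The avoidance conditions\<close>

lemma order_isomorphic_length_3E:
  assumes "order_isomorphic u [p, q, r]"
  obtains a b c where "u = [a, b, c]"
  using assms by (auto simp: order_isomorphic_def numeral_3_eq_3 length_Suc_conv)

lemma order_isomorphic_021: "order_isomorphic [a, b, c] [0, 2, 1] \<longleftrightarrow> a < c \<and> c < b"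
  by (auto simp: order_isomorphic_def less_Suc_eq numeral_3_eq_3)

lemma order_isomorphic_011: "order_isomorphic [a, b, c] [0, 1, 1] \<longleftrightarrow> a < b \<and> b = c"
  by (auto simp: order_isomorphic_def less_Suc_eq numeral_3_eq_3)

lemma order_isomorphic_010: "order_isomorphic [a, b, c] [0, 1, 0] \<longleftrightarrow> a < b \<and> a = c"
  by (auto simp: order_isomorphic_def less_Suc_eq numeral_3_eq_3)

lemma avoids_length_3_iff:
  "avoids w [p, q, r] \<longleftrightarrow>
    (\<forall>a b c. subseq [a, b, c] w \<longrightarrow> \<not> order_isomorphic [a, b, c] [p, q, r])"
  unfolding avoids_def by (metis order_isomorphic_length_3E)

lemma subseq_singleton_iff: "subseq [a] w \<longleftrightarrow> a \<in> set w"
  by (induction w) auto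

lemma subseq_pair_Cons_iff:
  "subseq [a, b] (x # w) \<longleftrightarrow> a = x \<and> b \<in> set w \<or> subseq [a, b] w"
  by (auto simp: subseq_singleton_iff dest: subseq_Cons')

lemma sorted_wrt_iff_subseq: "sorted_wrt R w \<longleftrightarrow> (\<forall>a b. subseq [a, b] w \<longrightarrow> R a b)"
proof (induction w)
  case (Cons x w)
  then show ?case unfolding sorted_wrt.simps subseq_pair_Cons_iff by blast
qed simp

lemma subseq_pair_filter_iff:
  "subseq [a, b] (filter P w) \<longleftrightarrow> P a \<and> P b \<and> subseq [a, b] w"
  by (induction w) (auto simp: subseq_pair_Cons_iff simp del: subseq_Cons2_iff)

lemma subseq_tail_of_triple:
  assumes "subseq [a, b, c] (x # w)"
  shows "subseq [b, c] w"
  using assms by (auto split: if_splits dest: subseq_Cons')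

text \<open>
  The leading \<open>0\<close> serves as the first letter of every forbidden pattern needed here, so both
  conditions reduce to conditions on pairs of entries.
\<close>

lemma avoids_011_021_iff:
  "avoids (0 # v) [0, 1, 1] \<and> avoids (0 # v) [0, 2, 1]
    \<longleftrightarrow> sorted_wrt (<) (filter (\<lambda>x. 0 < x) (0 # v))" (is "?avoids \<longleftrightarrow> ?increasing")
proof
  assume ?avoids
  have "b < c" if bc: "subseq [b, c] v" "0 < b" "0 < c" for b c
  proof (rule ccontr)
    assume "\<not> b < c"
    then have "b = c \<or> c < b" by auto
    moreover have "subseq [0, b, c] (0 # v)" using bc by simp
    ultimately show False
      using \<open>?avoids\<close> bc
      unfolding avoids_length_3_iff order_isomorphic_011 order_isomorphic_021 by blast
  qed
  then show ?increasing by (simp add: sorted_wrt_iff_subseq subseq_pair_filter_iff)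
next
  assume ?increasing
  then have "b < c" if "subseq [b, c] v" "0 < b" "0 < c" for b c
    using that by (simp add: sorted_wrt_iff_subseq subseq_pair_filter_iff)
  then have "b < c" if "subseq [a, b, c] (0 # v)" "a < b" "a < c" for a b c
    using that subseq_tail_of_triple[of a b c 0 v] by fastforce
  then show ?avoids
    unfolding avoids_length_3_iff order_isomorphic_011 order_isomorphic_021
    by (metis less_asym less_irrefl order.strict_trans)
qed

lemma avoids_010_021_iff:
  "avoids (0 # v) [0, 1, 0] \<and> avoids (0 # v) [0, 2, 1] \<longleftrightarrow> sorted (0 # v)"
  (is "?avoids \<longleftrightarrow> _")
proof
  assume ?avoids
  have "b \<le> c" if bc: "subseq [b, c] v" for b c
  proof (rule ccontr)
    assume "\<not> b \<le> c"
    \<comment> \<open>The entries \<open>0, b, c\<close> form \<open>010\<close> if \<open>c = 0\<close> and \<open>021\<close> otherwise.\<close>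
    then have "0 < b \<and> 0 = c \<or> 0 < c \<and> c < b" by auto
    moreover have "subseq [0, b, c] (0 # v)" using bc by simp
    ultimately show False
      using \<open>?avoids\<close>
      unfolding avoids_length_3_iff order_isomorphic_010 order_isomorphic_021 by blast
  qed
  then show "sorted (0 # v)" by (simp add: sorted_wrt_iff_subseq)
next
  assume "sorted (0 # v)"
  then have "sorted v" by simp
  then have "b \<le> c" if "subseq [a, b, c] (0 # v)" for a b c
    using subseq_tail_of_triple[OF that] by (simp add: sorted_wrt_iff_subseq)
  then show ?avoids
    unfolding avoids_length_3_iff order_isomorphic_010 order_isomorphic_021
    by (metis not_less)
qed

lemma inversion_sequence_starts_with_0:
  assumes "e \<in> inversion_sequences n" "n \<ge> 1"
  obtains v where "e = 0 # v"
  using assms by (cases e) (auto simp: inversion_sequences_def)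

lemma inversion_sequences_avoiding_011_021:
  assumes "n \<ge> 1"
  shows "inversion_sequences_avoiding n ([0, 1, 1], [0, 2, 1])
    = {e \<in> inversion_sequences n. sorted_wrt (<) (filter (\<lambda>x. 0 < x) e)}"
  unfolding inversion_sequences_avoiding_def fst_conv snd_conv
  using inversion_sequence_starts_with_0[OF _ assms] avoids_011_021_iff
  by (metis (no_types, lifting))

lemma inversion_sequences_avoiding_010_021:
  assumes "n \<ge> 1"
  shows "inversion_sequences_avoiding n ([0, 1, 0], [0, 2, 1])
    = {e \<in> inversion_sequences n. sorted e}"
  unfolding inversion_sequences_avoiding_def fst_conv snd_conv
  using inversion_sequence_starts_with_0[OF _ assms] avoids_010_021_iff
  by (metis (no_types, lifting))

section \<open>Both classes are counted by the Catalan numbers\<close>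

lemma card_nonzero_increasing_inversion_sequences:
  "real (card {e \<in> inversion_sequences n. sorted_wrt (<) (filter (\<lambda>x. 0 < x) e)}) = catalan n"
proof (rule card_inversion_sequences_eq_catalan)
  fix e :: "nat list" and m
  assume e: "sorted_wrt (<) (filter (\<lambda>x. 0 < x) e)" and bound: "set e \<subseteq> {..m}"
  have snoc: "sorted_wrt (<) (filter (\<lambda>x. 0 < x) (e @ [x])) \<longleftrightarrow> x = 0 \<or> (\<forall>y\<in>set e. y < x)" for x
    using e by (auto simp: sorted_wrt_append)
  show "\<exists>!x. x \<le> m \<and> m \<in> set (e @ [x]) \<and> sorted_wrt (<) (filter (\<lambda>x. 0 < x) (e @ [x]))"
  proof (cases "m \<in> set e")
    case True
    then show ?thesis unfolding snoc by (intro ex1I[of _ 0]) auto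
  next
    case False
    with bound have "\<forall>y\<in>set e. y < m" by (auto simp: le_less)
    with False show ?thesis unfolding snoc by (intro ex1I[of _ m]) auto
  qed
qed (auto simp: sorted_wrt_append)

lemma card_sorted_inversion_sequences:
  "real (card {e \<in> inversion_sequences n. sorted e}) = catalan n"
proof (rule card_inversion_sequences_eq_catalan)
  fix e :: "nat list" and m
  assume "sorted e" and "set e \<subseteq> {..m}"
  then have "sorted (e @ [m])" by (auto simp: sorted_append)
  \<comment> \<open>If \<open>m\<close> occurs in \<open>e\<close>, the new letter is at least \<open>m\<close>, otherwise it is \<open>m\<close>.\<close>
  moreover have "x = m" if "x \<le> m" "m \<in> set (e @ [x])" "sorted (e @ [x])" for x
    using that by (auto simp: sorted_append)
  ultimately show "\<exists>!x. x \<le> m \<and> m \<in> set (e @ [x]) \<and> sorted (e @ [x])"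
    by (intro ex1I[of _ m]) auto
qed (auto simp: sorted_append)

theorem theorem2p17:
  fixes n :: nat and p :: "nat list \<times> nat list"
  assumes "n \<ge> 1"
    and "p \<in> {([0, 1, 1], [0, 2, 1]), ([0, 1, 0], [0, 2, 1])}"
  shows "real (card (inversion_sequences_avoiding n p)) = catalan n"
  using assms inversion_sequences_avoiding_011_021 inversion_sequences_avoiding_010_021
    card_nonzero_increasing_inversion_sequences card_sorted_inversion_sequences
  by auto

end
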